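(* Let $m\ge 3$ and $0\le r<1$. There is a constant $c(r)$ such that the following holds. Let $u(t)$ be a weak solution of the Navier-Stokes equations in $\mathbb{R}^m$ with initial velocity $u_0$, and let $v(t)=u(t)-e^{t\Delta}u_0$. Then for every $t\ge 0$, every $p$ with $1\le p<m/(m-1+r)$, and every $h\in\mathbb{R}^m$ with $|h|\le 1$, $$\|v(t)(\cdot+h)-v(t)(\cdot)\|_p\le c(r)\,|h|^r\,\|v(t)\|_{\mathcal{L}^p_r}.$$
   Context: Function spaces are also used for $\mathbb{R}^m$-valued fields, componentwise. $e^{t\Delta}$ is the heat semigroup on $\mathbb{R}^m$. For $1\le p<\infty$ and $r\ge 0$, $\mathcal{L}^p_r(\mathbb{R}^m)=(I-\Delta)^{-r/2}L^p(\mathbb{R}^m)\subset L^p(\mathbb{R}^m)$ with norm $\|f\|_{\mathcal{L}^p_r}=\|(I-\Delta)^{r/2}f\|_p$. Under the stated conditions on $p$ and $r$ one has $v(t)\in\mathcal{L}^p_r(\mathbb{R}^m)$. The dimension $m$ is fixed, and $c(r)$ may depend on it. Weak solution: let $u_0\in L^2(\mathbb{R}^m)$ be divergence free. $u$ is a weak solution of the Navier-Stokes equations with initial velocity $u_0$ if for each $T>0$, $u\in L^\infty([0,T];L^2(\mathbb{R}^m))\cap L^2([0,T];H^1(\mathbb{R}^m))$, $\nabla_x\cdot u(t,x)=0$ (distributional derivatives), and for every $\mathbb{R}^m$-valued $\phi\in C_0^\infty([0,T)\times\mathbb{R}^m)$ with $\nabla_x\cdot\phi(s,x)=0$, $$\int_0^t[-(u(s),\partial_s\phi(s))+(\nabla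 u(s),\nabla\phi(s))+(u(s)\cdot\nabla u(s),\phi(s))]\,ds=(u_0,\phi(0))-(u(t),\phi(t))$$ for a.e. $t\in[0,T)$, including $t=0$. Here $(u,v)=\sum_i\int u_iv_i\,dx$ (used whenever the product is integrable), $(\nabla u,\nabla v)=\sum_{i,j}\int\partial_{x_i}u_j\partial_{x_i}v_j\,dx$, $(u\cdot\nabla u)_j=\sum_k u_k\partial_{x_k}u_j$. The energy inequality is not assumed. Convention: a weak solution is a priori defined only for a.e. $t$; after modification on a null set of times it is weakly continuous from $[0,\infty)$ to $L^2(\mathbb{R}^m)$ with $u(0)=u_0$, and $u(t)$ denotes this weakly continuous version. *)

theory Defs
  imports "HOL-Analysis.Analysis"
begin

text \<open>
  Euclidean space of dimension m is \<open>real ^ 'm\<close>. Elements of function spaces are represented by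
  functions, to be read up to equality almost everywhere. All norms of function spaces are
  extended: they take the value \<open>\<infinity>\<close> exactly off the space, so that \<open>lp_norm p f < \<infinity>\<close> says that
  \<open>f\<close> is in \<open>L\<^sup>p\<close>.
\<close>

section \<open>Function spaces\<close>

text \<open>
  The pointwise norm is Euclidean, for vector fields as well as for matrix fields (the norm of
  \<open>real ^ 'm ^ 'm\<close> is the Frobenius norm). The case distinction is the \<open>p\<close>-th root on \<open>ennreal\<close>.
\<close>

definition lp_norm :: "real \<Rightarrow> (real ^ 'm \<Rightarrow> 'b::euclidean_space) \<Rightarrow> ennreal" where
  "lp_norm p f =
     (let I = (\<integral>\<^sup>+x. ennreal (norm (f x) powr p) \<partial>lebesgue)
      in if f \<in> borel_measurable lebesgue \<and> I < \<infinity>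
         then ennreal (enn2real I powr (1 / p)) else \<infinity>)"

definition l2_inner :: "(real ^ 'm \<Rightarrow> 'b::euclidean_space) \<Rightarrow> (real ^ 'm \<Rightarrow> 'b) \<Rightarrow> real" where
  "l2_inner f g = (LINT x|lebesgue. f x \<bullet> g x)"

primrec cont_diff :: "nat \<Rightarrow> ('a::euclidean_space \<Rightarrow> 'b::real_normed_vector) \<Rightarrow> bool" where
  "cont_diff 0 f \<longleftrightarrow> continuous_on UNIV f"
| "cont_diff (Suc k) f \<longleftrightarrow>
     (\<forall>x. f differentiable (at x)) \<and>
     (\<forall>b\<in>Basis. cont_diff k (\<lambda>x. frechet_derivative f (at x) b))"

definition smooth :: "('a::euclidean_space \<Rightarrow> 'b::real_normed_vector) \<Rightarrow> bool" where
  "smooth f \<longleftrightarrow> (\<forall>k. cont_diff k f)"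

definition test_function :: "(real ^ 'm \<Rightarrow> real) \<Rightarrow> bool" where
  "test_function \<psi> \<longleftrightarrow> smooth \<psi> \<and> (\<exists>K. compact K \<and> (\<forall>x. x \<notin> K \<longrightarrow> \<psi> x = 0))"

definition pderiv_x :: "'m \<Rightarrow> (real ^ 'm \<Rightarrow> real) \<Rightarrow> real ^ 'm \<Rightarrow> real" where
  "pderiv_x i \<psi> x = frechet_derivative \<psi> (at x) (axis i 1)"

definition locally_integrable :: "(real ^ 'm \<Rightarrow> 'b::euclidean_space) \<Rightarrow> bool" where
  "locally_integrable f \<longleftrightarrow> (\<forall>K. compact K \<longrightarrow> set_integrable lebesgue K f)"

text \<open>The entry \<open>G x $ i $ j\<close> is the distributional derivative of \<open>f\<^sub>j\<close> in direction \<open>x\<^sub>i\<close>.\<close>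

definition has_weak_grad :: "(real ^ 'm \<Rightarrow> real ^ 'm) \<Rightarrow> (real ^ 'm \<Rightarrow> real ^ 'm ^ 'm) \<Rightarrow> bool" where
  "has_weak_grad f G \<longleftrightarrow> locally_integrable f \<and> locally_integrable G \<and>
     (\<forall>\<psi> i j. test_function \<psi> \<longrightarrow>
        (LINT x|lebesgue. f x $ j * pderiv_x i \<psi> x) = - (LINT x|lebesgue. G x $ i $ j * \<psi> x))"

text \<open>The choice is immaterial: a weak gradient is unique almost everywhere.\<close>

definition weak_grad :: "(real ^ 'm \<Rightarrow> real ^ 'm) \<Rightarrow> real ^ 'm \<Rightarrow> real ^ 'm ^ 'm" where
  "weak_grad f = (SOME G. has_weak_grad f G)"

text \<open>
  The norm of a pair is the square root of the sum of the squares of the norms of its components,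
  so the value below is the square root of \<open>\<parallel>f\<parallel>\<^sup>2 + \<parallel>\<nabla>f\<parallel>\<^sup>2\<close>, with \<open>L\<^sup>2\<close> norms.
\<close>

definition h1_norm :: "(real ^ 'm \<Rightarrow> real ^ 'm) \<Rightarrow> ennreal" where
  "h1_norm f = (if \<exists>G. has_weak_grad f G then lp_norm 2 (\<lambda>x. (f x, weak_grad f x)) else \<infinity>)"

definition weakly_div_free :: "(real ^ 'm \<Rightarrow> real ^ 'm) \<Rightarrow> bool" where
  "weakly_div_free f \<longleftrightarrow>
     (\<forall>\<psi>. test_function \<psi> \<longrightarrow> (LINT x|lebesgue. (\<Sum>i\<in>UNIV. f x $ i * pderiv_x i \<psi> x)) = 0)"

section \<open>Vector-valued functions of time\<close>

text \<open>
  Strong (Bochner) measurability on \<open>[0,T]\<close> with values in the normed space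
  \<open>{f. N f < \<infinity>}\<close>: almost everywhere limit, in the norm \<open>N\<close>, of simple functions.
\<close>

definition simple_in :: "((real ^ 'm \<Rightarrow> real ^ 'm) \<Rightarrow> ennreal) \<Rightarrow> real \<Rightarrow>
    (real \<Rightarrow> real ^ 'm \<Rightarrow> real ^ 'm) \<Rightarrow> bool" where
  "simple_in N T s \<longleftrightarrow> finite (s ` {0..T}) \<and> (\<forall>t\<in>{0..T}. N (s t) < \<infinity>) \<and>
     (\<forall>g. {t\<in>{0..T}. s t = g} \<in> sets lebesgue)"

definition strongly_measurable_in :: "((real ^ 'm \<Rightarrow> real ^ 'm) \<Rightarrow> ennreal) \<Rightarrow> real \<Rightarrow>
    (real \<Rightarrow> real ^ 'm \<Rightarrow> real ^ 'm) \<Rightarrow> bool" where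
  "strongly_measurable_in N T u \<longleftrightarrow>
     (\<exists>s. (\<forall>n. simple_in N T (s n)) \<and>
          (AE t in lebesgue. t \<in> {0..T} \<longrightarrow> (\<lambda>n. N (\<lambda>x. u t x - s n t x)) \<longlonglongrightarrow> 0))"

definition in_Linf_L2 :: "real \<Rightarrow> (real \<Rightarrow> real ^ 'm \<Rightarrow> real ^ 'm) \<Rightarrow> bool" where
  "in_Linf_L2 T u \<longleftrightarrow> strongly_measurable_in (lp_norm 2) T u \<and>
     (\<exists>C::real. AE t in lebesgue. t \<in> {0..T} \<longrightarrow> lp_norm 2 (u t) \<le> ennreal C)"

definition in_L2_H1 :: "real \<Rightarrow> (real \<Rightarrow> real ^ 'm \<Rightarrow> real ^ 'm) \<Rightarrow> bool" where
  "in_L2_H1 T u \<longleftrightarrow> strongly_measurable_in h1_norm T u \<and>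
     (\<integral>\<^sup>+t. indicator {0..T} t * (h1_norm (u t))\<^sup>2 \<partial>lebesgue) < \<infinity>"

section \<open>Weak solutions of the Navier-Stokes equations\<close>

definition dt_field :: "(real \<times> (real ^ 'm) \<Rightarrow> real ^ 'm) \<Rightarrow> real \<Rightarrow> real ^ 'm \<Rightarrow> real ^ 'm" where
  "dt_field \<phi> s x = frechet_derivative \<phi> (at (s, x)) (1, 0)"

definition grad_field :: "(real \<times> (real ^ 'm) \<Rightarrow> real ^ 'm) \<Rightarrow> real \<Rightarrow> real ^ 'm \<Rightarrow> real ^ 'm ^ 'm" where
  "grad_field \<phi> s x = (\<chi> i j. frechet_derivative \<phi> (at (s, x)) (0, axis i 1) $ j)"

text \<open>
  Smooth fields on the half-open slab \<open>[0,T) \<times> R\<^sup>m\<close> are represented by smooth extensions to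
  \<open>R \<times> R\<^sup>m\<close>; support and divergence are prescribed on the slab only, and the support may meet
  \<open>t = 0\<close>.
\<close>

definition div_free_test_field :: "real \<Rightarrow> (real \<times> (real ^ 'm) \<Rightarrow> real ^ 'm) \<Rightarrow> bool" where
  "div_free_test_field T \<phi> \<longleftrightarrow> smooth \<phi> \<and>
     (\<exists>K. compact K \<and> K \<subseteq> {0..<T} \<times> UNIV \<and> (\<forall>z \<in> {0..<T} \<times> UNIV - K. \<phi> z = 0)) \<and>
     (\<forall>s\<in>{0..<T}. \<forall>x. (\<Sum>i\<in>UNIV. grad_field \<phi> s x $ i $ i) = 0)"

definition convection :: "(real ^ 'm \<Rightarrow> real ^ 'm) \<Rightarrow> real ^ 'm \<Rightarrow> real ^ 'm" where
  "convection f x = (\<chi> j. \<Sum>k\<in>UNIV. f x $ k * weak_grad f x $ k $ j)"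

definition weak_identity :: "(real ^ 'm \<Rightarrow> real ^ 'm) \<Rightarrow> (real \<Rightarrow> real ^ 'm \<Rightarrow> real ^ 'm) \<Rightarrow>
    (real \<times> (real ^ 'm) \<Rightarrow> real ^ 'm) \<Rightarrow> real \<Rightarrow> bool" where
  "weak_identity u0 u \<phi> t \<longleftrightarrow>
     (LINT s:{0..t}|lebesgue.
        - l2_inner (u s) (dt_field \<phi> s)
        + l2_inner (weak_grad (u s)) (grad_field \<phi> s)
        + l2_inner (convection (u s)) (\<lambda>x. \<phi> (s, x)))
     = l2_inner u0 (\<lambda>x. \<phi> (0, x)) - l2_inner (u t) (\<lambda>x. \<phi> (t, x))"

definition weak_solution :: "(real ^ 'm \<Rightarrow> real ^ 'm) \<Rightarrow> (real \<Rightarrow> real ^ 'm \<Rightarrow> real ^ 'm) \<Rightarrow> bool" where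
  "weak_solution u0 u \<longleftrightarrow>
     lp_norm 2 u0 < \<infinity> \<and> weakly_div_free u0 \<and>
     (\<forall>T>0. in_Linf_L2 T u \<and> in_L2_H1 T u \<and>
        (AE t in lebesgue. t \<in> {0..T} \<longrightarrow> weakly_div_free (u t)) \<and>
        (\<forall>\<phi>. div_free_test_field T \<phi> \<longrightarrow>
           (AE t in lebesgue. t \<in> {0..<T} \<longrightarrow> weak_identity u0 u \<phi> t) \<and>
           weak_identity u0 u \<phi> 0))"

text \<open>The normalisation of a weak solution on a null set of times.\<close>

definition weakly_continuous_version ::
    "(real ^ 'm \<Rightarrow> real ^ 'm) \<Rightarrow> (real \<Rightarrow> real ^ 'm \<Rightarrow> real ^ 'm) \<Rightarrow> bool" where
  "weakly_continuous_version u0 u \<longleftrightarrow>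
     (\<forall>t\<ge>0. lp_norm 2 (u t) < \<infinity>) \<and>
     (\<forall>w. lp_norm 2 w < \<infinity> \<longrightarrow> continuous_on {0..} (\<lambda>t. l2_inner (u t) w)) \<and>
     (AE x in lebesgue. u 0 x = u0 x)"

section \<open>Heat semigroup and Bessel potentials\<close>

definition heat_kernel :: "real \<Rightarrow> real ^ 'm \<Rightarrow> real" where
  "heat_kernel t x = (4 * pi * t) powr (- (real CARD('m) / 2)) * exp (- (norm x)\<^sup>2 / (4 * t))"

definition heat_semigroup :: "real \<Rightarrow> (real ^ 'm \<Rightarrow> real ^ 'm) \<Rightarrow> real ^ 'm \<Rightarrow> real ^ 'm" where
  "heat_semigroup t f =
     (if t = 0 then f else (\<lambda>x. LINT y|lebesgue. heat_kernel t (x - y) *\<^sub>R f y))"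

text \<open>
  The negative power \<open>(I - \<Delta>)\<close> to the \<open>-r/2\<close> is the Bessel potential of order \<open>r\<close>, defined as in
  Stein, Singular Integrals and Differentiability Properties of Functions, Chapter V.3: convolution
  with the kernel below for \<open>r > 0\<close>, and the identity for \<open>r = 0\<close>. The kernel is that of the
  subordination formula: the integral of \<open>s\<^bsup>r/2-1\<^esup> e\<^bsup>-s\<^esup> e\<^bsup>s\<Delta>\<^esup>\<close> over \<open>s > 0\<close>, divided by
  \<open>\<Gamma>(r/2)\<close>; its Fourier multiplier is the power \<open>-r/2\<close> of \<open>1 + |\<xi>|\<^sup>2\<close>.
\<close>

definition bessel_kernel :: "real \<Rightarrow> real ^ 'm \<Rightarrow> real" where
  "bessel_kernel r x =
     (LINT s:{0<..}|lebesgue. s powr (r / 2 - 1) * exp (- s) * heat_kernel s x) / Gamma (r / 2)"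

definition bessel_potential :: "real \<Rightarrow> (real ^ 'm \<Rightarrow> real ^ 'm) \<Rightarrow> real ^ 'm \<Rightarrow> real ^ 'm" where
  "bessel_potential r g =
     (if r = 0 then g else (\<lambda>x. LINT y|lebesgue. bessel_kernel r (x - y) *\<^sub>R g y))"

definition is_bessel_density :: "real \<Rightarrow> real \<Rightarrow> (real ^ 'm \<Rightarrow> real ^ 'm) \<Rightarrow>
    (real ^ 'm \<Rightarrow> real ^ 'm) \<Rightarrow> bool" where
  "is_bessel_density p r f g \<longleftrightarrow> lp_norm p g < \<infinity> \<and> (AE x in lebesgue. f x = bessel_potential r g x)"

definition bessel_space :: "real \<Rightarrow> real \<Rightarrow> (real ^ 'm \<Rightarrow> real ^ 'm) set" where
  "bessel_space p r = {f. \<exists>g. is_bessel_density p r f g}"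

text \<open>
  On \<open>bessel_space p r\<close> the function chosen below is \<open>(I - \<Delta>)\<^bsup>r/2\<^esup> f\<close>, which is unique almost
  everywhere because the Bessel potential is injective on \<open>L\<^sup>p\<close>.
\<close>

definition bessel_norm :: "real \<Rightarrow> real \<Rightarrow> (real ^ 'm \<Rightarrow> real ^ 'm) \<Rightarrow> ennreal" where
  "bessel_norm p r f =
     (if f \<in> bessel_space p r then lp_norm p (SOME g. is_bessel_density p r f g) else \<infinity>)"

end

theory Submission
  imports Defs "HOL-Probability.Distributions"
begin

text \<open>
  Write \<open>v(t) = G\<^sub>r * g\<close> with \<open>g\<close> in \<open>L\<^sup>p\<close> and \<open>G\<^sub>r\<close> the Bessel kernel (for \<open>r = 0\<close> the triangle
  inequality is enough). By Young's inequality it suffices that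
  the \<open>L\<^sup>1\<close> norm of \<open>G\<^sub>r(\<cdot> + h) - G\<^sub>r\<close> is at most \<open>c |h|\<^sup>r\<close>. By subordination this follows from
  the bound \<open>min(2, C |h| / \<surd>s)\<close> for the \<open>L\<^sup>1\<close> norm of the corresponding difference of heat kernels at
  time \<open>s\<close>: integrate it against \<open>s\<^bsup>r/2-1\<^esup>\<close>, splitting at \<open>s = |h|\<^sup>2\<close>, where \<open>r < 1\<close> makes the
  integral up to \<open>\<infinity>\<close> converge.
\<close>

section \<open>Translation, reflection and convolution for Lebesgue measure\<close>

lemma AE_lborel_translation:
  fixes h :: "'a::euclidean_space"
  assumes "AE x in lborel. P x"
  shows "AE x in lborel. P (x + h)"
proof -
  have "AE x in distr lborel borel ((+) h). P x"
    using assms by (subst lborel_distr_plus)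
  then have "AE x in lborel. P (h + x)"
    by (rule AE_distrD[rotated]) simp
  then show ?thesis by (simp add: add.commute)
qed

lemma nn_integral_lborel_translation:
  fixes h :: "'a::euclidean_space"
  assumes [measurable]: "f \<in> borel_measurable borel"
  shows "(\<integral>\<^sup>+x. f (x + h) \<partial>lborel) = (\<integral>\<^sup>+x. f x \<partial>lborel)"
proof -
  have "(\<integral>\<^sup>+x. f x \<partial>lborel) = (\<integral>\<^sup>+x. f x \<partial>distr lborel borel ((+) h))"
    by (simp add: lborel_distr_plus)
  also have "\<dots> = (\<integral>\<^sup>+x. f (h + x) \<partial>lborel)"
    by (subst nn_integral_distr) auto
  finally show ?thesis by (simp add: add.commute)
qed

lemma nn_integral_lborel_reflection:
  fixes x :: "'a::euclidean_space"
  assumes [measurable]: "f \<in> borel_measurable borel"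
  shows "(\<integral>\<^sup>+y. f (x - y) \<partial>lborel) = (\<integral>\<^sup>+y. f y \<partial>lborel)"
proof -
  have "lborel = distr lborel borel (\<lambda>y::'a. x - y)"
    using lborel_affine[of "-1" x] by (simp add: density_1)
  then have "(\<integral>\<^sup>+y. f y \<partial>lborel) = (\<integral>\<^sup>+y. f y \<partial>distr lborel borel (\<lambda>y::'a. x - y))"
    by simp
  also have "\<dots> = (\<integral>\<^sup>+y. f (x - y) \<partial>lborel)"
    by (subst nn_integral_distr) auto
  finally show ?thesis by simp
qed

text \<open>Tonelli, followed by translation invariance of the inner integral.\<close>

lemma nn_integral_convolution:
  fixes F w :: "'a::euclidean_space \<Rightarrow> ennreal"
  assumes [measurable]: "F \<in> borel_measurable borel" "w \<in> borel_measurable borel"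
  shows "(\<integral>\<^sup>+x. \<integral>\<^sup>+y. F (x - y) * w y \<partial>lborel \<partial>lborel)
    = (\<integral>\<^sup>+x. F x \<partial>lborel) * (\<integral>\<^sup>+y. w y \<partial>lborel)"
proof -
  have "(\<integral>\<^sup>+x. \<integral>\<^sup>+y. F (x - y) * w y \<partial>lborel \<partial>lborel)
      = (\<integral>\<^sup>+y. \<integral>\<^sup>+x. F (x - y) * w y \<partial>lborel \<partial>lborel)"
    by (rule lborel_pair.Fubini') measurable
  also have "\<dots> = (\<integral>\<^sup>+y. (\<integral>\<^sup>+x. F x \<partial>lborel) * w y \<partial>lborel)"
    using nn_integral_lborel_translation[of F "- y" for y]
    by (simp add: nn_integral_multc)
  finally show ?thesis by (simp add: nn_integral_cmult)
qed

section \<open>Young's inequality for convolution with an integrable kernel\<close>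

text \<open>Tangent line of \<open>\<lambda>t. t powr p\<close> at \<open>l\<close>.\<close>

lemma le_powr_tangent:
  fixes p t l :: real
  assumes "1 \<le> p" "0 \<le> t" "0 < l"
  shows "t \<le> l powr (1 - p) / p * t powr p + l * (1 - 1 / p)"
proof (cases "t = 0")
  case False
  \<comment> \<open>Weighted arithmetic-geometric mean of \<open>(t / l) powr p\<close> and
    \<open>1\<close> gives the tangent at \<open>1\<close>; multiplying by \<open>l\<close> moves
    the point of tangency to \<open>l\<close>.\<close>
  have "((t / l) powr p) powr (1 / p) * 1 powr (1 - 1 / p) \<le> 1 / p * (t / l) powr p + (1 - 1 / p) * 1"
    using assms False by (intro Youngs_inequality_0) auto
  then have "t / l \<le> (t / l) powr p / p + (1 - 1 / p)"
    using assms False by (simp add: powr_powr)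
  then have "l * (t / l) \<le> l * ((t / l) powr p / p + (1 - 1 / p))"
    using assms by (intro mult_left_mono) auto
  then show ?thesis
    using assms False by (simp add: powr_divide powr_diff field_simps)
qed (use assms in simp)

text \<open>Jensen's inequality for the convex function \<open>t powr p\<close> and the measure with
  density \<open>K\<close>, whose mass is only bounded by \<open>A\<close>, hence the factor
  \<open>A powr (p - 1)\<close>. Integrating a tangent line against \<open>K\<close> bounds
  \<open>b\<close> by an affine expression, and the point of tangency is then optimised.\<close>

lemma nn_integral_jensen_powr:
  fixes K G :: "'a \<Rightarrow> real" and p A b :: real
  assumes [measurable]: "K \<in> borel_measurable M" "G \<in> borel_measurable M"
    and nonneg: "\<And>y. 0 \<le> K y" "\<And>y. 0 \<le> G y"
    and p: "1 \<le> p" and A: "0 < A" "(\<integral>\<^sup>+y. K y \<partial>M) \<le> ennreal A"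
    and b: "0 \<le> b" "ennreal b \<le> (\<integral>\<^sup>+y. ennreal (K y) * ennreal (G y) \<partial>M)"
  shows "ennreal (b powr p)
    \<le> ennreal (A powr (p - 1)) * (\<integral>\<^sup>+y. ennreal (K y) * ennreal (G y powr p) \<partial>M)"
    (is "_ \<le> _ * ?B")
proof (cases "?B = \<infinity>")
  case True
  with A show ?thesis by (simp add: ennreal_mult_top)
next
  case False
  define B where "B = enn2real ?B"
  have B: "?B = ennreal B" "0 \<le> B"
    using False by (simp_all add: B_def less_top[symmetric])
  \<comment> \<open>A strict upper bound \<open>\<beta>\<close> of \<open>B\<close> keeps the point
    of tangency positive even if \<open>B = 0\<close>; \<open>dense_ge\<close> then lets
    \<open>\<beta>\<close> decrease to \<open>B\<close>.\<close>
  have "b powr p / A powr (p - 1) \<le> \<beta>" if \<beta>: "B < \<beta>" for \<beta>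
  proof -
    \<comment> \<open>For this \<open>l\<close> the two terms of the bound add up to exactly
      \<open>a * \<beta> + c * A = A * l\<close>, and raising to the power \<open>p\<close> gives
      the claim.\<close>
    define l where "l = (\<beta> / A) powr (1 / p)"
    have \<beta>0: "0 < \<beta>" using B \<beta> by simp
    have l0: "0 < l" using A \<beta>0 by (simp add: l_def)
    have lp: "l powr p = \<beta> / A" using A p \<beta>0 by (simp add: l_def powr_powr)
    define a c where "a = l powr (1 - p) / p" and "c = l * (1 - 1 / p)"
    have ac: "0 \<le> a" "0 \<le> c" using p l0 by (simp_all add: a_def c_def)
    have tangent: "t \<le> a * t powr p + c" if "0 \<le> t" for t
      using le_powr_tangent[OF p that l0] by (simp add: a_def c_def)
    have "ennreal b \<le> (\<integral>\<^sup>+y. ennreal (K y) * ennreal (G y) \<partial>M)" by fact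
    also have "\<dots> \<le> (\<integral>\<^sup>+y. ennreal a * (ennreal (K y) * ennreal (G y powr p))
        + ennreal c * ennreal (K y) \<partial>M)"
    proof (rule nn_integral_mono)
      fix y
      have "K y * G y \<le> K y * (a * G y powr p + c)"
        using nonneg tangent[of "G y"] by (intro mult_left_mono) auto
      then have "ennreal (K y * G y)
          \<le> ennreal (a * (K y * G y powr p) + c * K y)"
        by (intro ennreal_leI) (simp add: algebra_simps)
      then show "ennreal (K y) * ennreal (G y) \<le> ennreal a *
          (ennreal (K y) * ennreal (G y powr p)) + ennreal c * ennreal (K y)"
        using nonneg[of y] ac by (simp add: ennreal_mult')
    qed
    also have "\<dots> = ennreal a * ?B
        + ennreal c * (\<integral>\<^sup>+y. K y \<partial>M)"
      by (simp add: nn_integral_add nn_integral_cmult)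
    also have "\<dots> \<le> ennreal a * ennreal \<beta> + ennreal c * ennreal A"
      using \<beta> A B by (intro add_mono mult_left_mono) (auto simp: ennreal_leI)
    also have "\<dots> = ennreal (a * \<beta> + c * A)"
      using ac A \<beta>0 by (simp add: ennreal_mult')
    also have "a * \<beta> + c * A = A * l"
    proof -
      have "\<beta> = A * l powr p" using lp A by simp
      then have "l powr (1 - p) * \<beta> = A * l"
        using l0 by (simp add: powr_diff)
      then show ?thesis using p by (simp add: a_def c_def field_simps)
    qed
    finally have "b \<le> A * l"
      using A l0 by (simp add: ennreal_le_iff)
    then have "b powr p \<le> (A * l) powr p"
      using b p by (intro powr_mono2) auto
    also have "\<dots> = A powr (p - 1) * \<beta>"
      using A l0 by (simp add: powr_mult lp powr_diff)
    finally show ?thesis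
      using A by (simp add: field_simps)
  qed
  then have "b powr p / A powr (p - 1) \<le> B"
    by (rule dense_ge)
  then have "b powr p \<le> A powr (p - 1) * B"
    using A by (simp add: field_simps)
  then show ?thesis
    using B by (simp add: ennreal_mult'[symmetric] ennreal_leI)
qed

text \<open>Jensen for the kernel \<open>K (x - y)\<close> at almost every \<open>x\<close>
  contributes \<open>A powr (p - 1)\<close>; integrating in \<open>x\<close> by Tonelli contributes
  the remaining factor \<open>A\<close>. Only domination of \<open>W\<close> enters, so that
  \<open>W\<close> can be the norm of a difference of convolutions.\<close>

lemma nn_integral_Young_powr:
  fixes K G W :: "'a::euclidean_space \<Rightarrow> real" and p A :: real
  assumes [measurable]: "K \<in> borel_measurable borel" "G \<in> borel_measurable borel"
    and nonneg: "\<And>y. 0 \<le> K y" "\<And>y. 0 \<le> G y" "\<And>x. 0 \<le> W x"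
    and p: "1 \<le> p" and A: "0 < A" "(\<integral>\<^sup>+y. K y \<partial>lborel) \<le> ennreal A"
    and W: "AE x in lborel. ennreal (W x) \<le> (\<integral>\<^sup>+y. ennreal (K (x - y)) * ennreal (G y) \<partial>lborel)"
  shows "(\<integral>\<^sup>+x. W x powr p \<partial>lborel) \<le> ennreal (A powr p) * (\<integral>\<^sup>+y. G y powr p \<partial>lborel)"
proof -
  have "(\<integral>\<^sup>+x. W x powr p \<partial>lborel) \<le> (\<integral>\<^sup>+x. ennreal (A powr (p - 1)) *
      (\<integral>\<^sup>+y. ennreal (K (x - y)) * ennreal (G y powr p) \<partial>lborel) \<partial>lborel)"
    using W
  proof (intro nn_integral_mono_AE, eventually_elim)
    case (elim x)
    have "(\<integral>\<^sup>+y. K (x - y) \<partial>lborel) \<le> ennreal A"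
      using A(2) by (subst nn_integral_lborel_reflection[where f = "\<lambda>y. ennreal (K y)"]) auto
    then show ?case
      using nonneg p A elim by (intro nn_integral_jensen_powr) auto
  qed
  also have "\<dots> = ennreal (A powr (p - 1)) * ((\<integral>\<^sup>+x. K x \<partial>lborel) * (\<integral>\<^sup>+y. G y powr p \<partial>lborel))"
    by (subst nn_integral_cmult)
       (simp_all add: nn_integral_convolution[where F = "\<lambda>y. ennreal (K y)" and w = "\<lambda>y. ennreal (G y powr p)"])
  also have "\<dots> \<le> ennreal (A powr (p - 1)) * (ennreal A * (\<integral>\<^sup>+y. G y powr p \<partial>lborel))"
    using A by (intro mult_left_mono mult_right_mono) auto
  also have "\<dots> = ennreal (A powr p) * (\<integral>\<^sup>+y. G y powr p \<partial>lborel)"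
    using A by (simp add: mult.assoc[symmetric] ennreal_mult'[symmetric] powr_diff)
  finally show ?thesis .
qed

text \<open>Since \<open>p \<ge> 1\<close>, \<open>norm (g y)\<close> is at most
  \<open>1 + norm (g y) powr p\<close>. The integrand is thus dominated by the integrable
  \<open>norm (G (x - y))\<close> plus an integrand whose integral is a convolution of two
  integrable functions, finite for almost every \<open>x\<close>.\<close>

lemma AE_integrable_convolution:
  fixes G :: "'a::euclidean_space \<Rightarrow> real" and g :: "'a \<Rightarrow> 'b::euclidean_space"
  assumes [measurable]: "G \<in> borel_measurable borel" "g \<in> borel_measurable borel"
    and G: "(\<integral>\<^sup>+y. norm (G y) \<partial>lborel) < \<infinity>"
    and p: "1 \<le> p" and g: "(\<integral>\<^sup>+y. norm (g y) powr p \<partial>lborel) < \<infinity>"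
  shows "AE x in lborel. integrable lborel (\<lambda>y. G (x - y) *\<^sub>R g y)"
proof -
  let ?J = "\<lambda>x. \<integral>\<^sup>+y. ennreal (norm (G (x - y))) * ennreal (norm (g y) powr p) \<partial>lborel"
  have "(\<integral>\<^sup>+x. ?J x \<partial>lborel) \<noteq> \<infinity>"
    using G g nn_integral_convolution[of "\<lambda>x. ennreal (norm (G x))" "\<lambda>y. ennreal (norm (g y) powr p)"]
    by (simp add: ennreal_mult_eq_top_iff less_top)
  then have "AE x in lborel. ?J x \<noteq> \<infinity>"
    by (intro nn_integral_PInf_AE) auto
  then show ?thesis
  proof eventually_elim
    case (elim x)
    have 1: "ennreal (norm (G (x - y) *\<^sub>R g y)) \<le>
        ennreal (norm (G (x - y))) + ennreal (norm (G (x - y))) * ennreal (norm (g y) powr p)" for y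
    proof -
      have "norm (g y) \<le> 1 + norm (g y) powr p"
      proof (cases "norm (g y) \<le> 1")
        case False
        then have "norm (g y) powr 1 \<le> norm (g y) powr p"
          using p by (intro powr_mono) auto
        then show ?thesis by simp
      qed (simp add: add_increasing2)
      then have "norm (G (x - y)) * norm (g y) \<le> norm (G (x - y)) * (1 + norm (g y) powr p)"
        by (intro mult_left_mono) auto
      then have "ennreal (norm (G (x - y) *\<^sub>R g y))
          \<le> ennreal (norm (G (x - y)) + norm (G (x - y)) * norm (g y) powr p)"
        by (intro ennreal_leI) (simp add: algebra_simps)
      then show ?thesis
        by (simp add: ennreal_mult')
    qed
    have "(\<integral>\<^sup>+y. norm (G (x - y) *\<^sub>R g y) \<partial>lborel) \<le> (\<integral>\<^sup>+y. norm (G (x - y)) \<partial>lborel) + ?J x"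
      by (subst nn_integral_add[symmetric]) (use 1 in \<open>auto intro!: nn_integral_mono simp del: norm_scaleR\<close>)
    also have "\<dots> < \<infinity>"
      using elim G by (subst nn_integral_lborel_reflection[where f = "\<lambda>y. ennreal (norm (G y))"])
        (auto simp: less_top)
    finally show ?case
      by (intro integrableI_bounded) auto
  qed
qed

text \<open>The difference of \<open>f\<close> is the convolution of \<open>g\<close> with the
  difference of \<open>G\<close>, to which Young's inequality applies.\<close>

lemma nn_integral_convolution_translation:
  fixes G :: "'a::euclidean_space \<Rightarrow> real" and g :: "'a \<Rightarrow> 'b::euclidean_space"
  assumes meas [measurable]: "G \<in> borel_measurable borel" "g \<in> borel_measurable borel"
    and G: "(\<integral>\<^sup>+y. norm (G y) \<partial>lborel) < \<infinity>"
    and p: "1 \<le> p" and g: "(\<integral>\<^sup>+y. norm (g y) powr p \<partial>lborel) < \<infinity>"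
    and A: "0 < A" "(\<integral>\<^sup>+y. norm (G (y + h) - G y) \<partial>lborel) \<le> ennreal A"
    and f: "AE x in lborel. f x = (LINT y|lborel. G (x - y) *\<^sub>R g y)"
  shows "(\<integral>\<^sup>+x. norm (f (x + h) - f x) powr p \<partial>lborel)
    \<le> ennreal (A powr p) * (\<integral>\<^sup>+y. norm (g y) powr p \<partial>lborel)"
proof (rule nn_integral_Young_powr[where K = "\<lambda>y. norm (G (y + h) - G y)"])
  have int: "AE x in lborel. integrable lborel (\<lambda>y. G (x - y) *\<^sub>R g y)"
    by (rule AE_integrable_convolution[OF meas G p g])
  show "AE x in lborel. ennreal (norm (f (x + h) - f x)) \<le>
      (\<integral>\<^sup>+y. ennreal (norm (G (x - y + h) - G (x - y))) * ennreal (norm (g y)) \<partial>lborel)"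
    \<comment> \<open>Both convolution integrals, at \<open>x\<close> and at \<open>x + h\<close>,
      must converge before they can be subtracted, a Bochner integral being \<open>0\<close> by
      default otherwise.\<close>
    using f int AE_lborel_translation[OF f, of h] AE_lborel_translation[OF int, of h]
  proof eventually_elim
    case (elim x)
    have "f (x + h) - f x = (LINT y|lborel. G (x + h - y) *\<^sub>R g y - G (x - y) *\<^sub>R g y)"
      using elim by simp
    also have "norm \<dots> \<le> (\<integral>\<^sup>+y. norm (G (x + h - y) *\<^sub>R g y - G (x - y) *\<^sub>R g y) \<partial>lborel)"
      using elim by (intro integral_norm_bound_ennreal) auto
    also have "\<dots> = (\<integral>\<^sup>+y. ennreal (norm (G (x - y + h) - G (x - y))) * ennreal (norm (g y)) \<partial>lborel)"
      by (simp add: scaleR_diff_left[symmetric] ennreal_mult' diff_add_eq del: scaleR_diff_left)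
    finally show ?case .
  qed
qed (use p A in auto)

section \<open>The heat kernel: mass one and modulus of continuity in L^1\<close>

lemma heat_kernel_measurable [measurable]:
  assumes [measurable]: "f \<in> borel_measurable M" "g \<in> borel_measurable M"
  shows "(\<lambda>z. heat_kernel (f z) (g z :: real ^ 'm)) \<in> borel_measurable M"
  unfolding heat_kernel_def by measurable

lemma heat_kernel_nonneg: "0 \<le> heat_kernel s x"
  by (simp add: heat_kernel_def)

text \<open>The kernel at time \<open>s\<close> is the product over the coordinates of centred
  normal densities of variance \<open>2 * s\<close>, each of mass one.\<close>

lemma nn_integral_heat_kernel:
  assumes "0 < s"
  shows "(\<integral>\<^sup>+x. heat_kernel s (x :: real ^ 'm) \<partial>lborel) = 1"
proof -
  define \<sigma> where "\<sigma> = sqrt (2 * s)"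
  have \<sigma>: "0 < \<sigma>" "\<sigma>\<^sup>2 = 2 * s" using assms by (simp_all add: \<sigma>_def)
  have "heat_kernel s x = (\<Prod>b\<in>Basis. normal_density 0 \<sigma> (x \<bullet> b))" for x :: "real ^ 'm"
  proof -
    have "normal_density 0 \<sigma> t = 1 / sqrt (4 * pi * s) * exp (- t\<^sup>2 / (4 * s))" for t
      by (simp add: normal_density_def \<sigma> mult.commute mult.left_commute)
    then have "(\<Prod>b\<in>Basis. normal_density 0 \<sigma> (x \<bullet> b))
        = (\<Prod>b\<in>(Basis :: (real^'m) set). 1 / sqrt (4 * pi * s)) * (\<Prod>b\<in>Basis. exp (- (x \<bullet> b)\<^sup>2 / (4 * s)))"
      by (simp only: prod.distrib)
    also have "\<dots> = (1 / sqrt (4 * pi * s)) ^ CARD('m) * exp (\<Sum>b\<in>Basis. - (x \<bullet> b)\<^sup>2 / (4 * s))"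
      by (subst prod_constant) (simp add: exp_sum)
    also have "(\<Sum>b\<in>Basis. - (x \<bullet> b)\<^sup>2 / (4 * s)) = - (norm x)\<^sup>2 / (4 * s)"
    proof -
      have "(norm x)\<^sup>2 = (\<Sum>b\<in>Basis. (x \<bullet> b)\<^sup>2)"
        unfolding power2_norm_eq_inner by (subst euclidean_inner) (simp add: power2_eq_square)
      then show ?thesis
        by (simp add: sum_divide_distrib sum_negf)
    qed
    also have "(1 / sqrt (4 * pi * s)) ^ CARD('m) = (4 * pi * s) powr (- (real CARD('m) / 2))"
    proof -
      have "1 / sqrt (4 * pi * s) = (4 * pi * s) powr (- (1 / 2))"
        using assms by (simp add: powr_minus_divide powr_half_sqrt)
      then have "(1 / sqrt (4 * pi * s)) ^ CARD('m) = ((4 * pi * s) powr (- (1 / 2))) powr real CARD('m)"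
        using assms by (simp add: powr_realpow)
      then show ?thesis by (simp add: powr_powr)
    qed
    finally show ?thesis by (simp add: heat_kernel_def)
  qed
  then have "(\<integral>\<^sup>+x. heat_kernel s (x :: real ^ 'm) \<partial>lborel)
      = (\<integral>\<^sup>+x. (\<Prod>b\<in>(Basis :: (real ^ 'm) set). ennreal (normal_density 0 \<sigma> (x \<bullet> b))) \<partial>lborel)"
    by (simp add: prod_ennreal)
  also have "\<dots> = (\<Prod>b\<in>(Basis :: (real^'m) set). (\<integral>\<^sup>+x. ennreal (normal_density 0 \<sigma> x) \<partial>lborel))"
    by (rule nn_integral_lborel_prod[where f = "\<lambda>_ t. ennreal (normal_density 0 \<sigma> t)"]) auto
  also have "(\<integral>\<^sup>+x. ennreal (normal_density 0 \<sigma> x) \<partial>lborel) = 1"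
    using \<sigma> by (subst nn_integral_eq_integral) auto
  finally show ?thesis by simp
qed

text \<open>A mean value bound, obtained from \<open>1 + t \<le> exp t\<close>; the common lower
  bound \<open>c\<close> of the exponents replaces the unknown intermediate point.\<close>

lemma abs_exp_minus_diff_le:
  fixes a b c :: real
  assumes "c \<le> a" "c \<le> b"
  shows "\<bar>exp (- a) - exp (- b)\<bar> \<le> \<bar>a - b\<bar> * exp (- c)"
proof -
  have *: "exp (- a) - exp (- b) \<le> (b - a) * exp (- c)" if "a \<le> b" "c \<le> a" for a b
  proof -
    have "1 - exp (a - b) \<le> b - a"
      using exp_ge_add_one_self[of "a - b"] by linarith
    then have "exp (- a) * (1 - exp (a - b)) \<le> exp (- c) * (b - a)"
      using that by (intro mult_mono) auto
    also have "exp (- a) * (1 - exp (a - b)) = exp (- a) - exp (- b)"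
      by (simp add: right_diff_distrib exp_add[symmetric])
    finally show ?thesis by (simp add: mult.commute)
  qed
  show ?thesis
    using *[of a b] *[of b a] assms by (cases "a \<le> b") auto
qed

text \<open>The translate is absorbed by the kernel at the later time \<open>4 * s\<close>.\<close>

lemma heat_kernel_translation_le:
  fixes x h :: "real ^ 'm"
  assumes s: "0 < s" and h: "norm h \<le> sqrt s"
  shows "\<bar>heat_kernel s (x + h) - heat_kernel s x\<bar>
    \<le> 5 / 4 * exp (1 / 4) * 2 ^ CARD('m) * (norm h / sqrt s) * heat_kernel (4 * s) x"
proof -
  define \<sigma> where "\<sigma> = sqrt s"
  have \<sigma>: "0 < \<sigma>" and s_eq: "s = \<sigma>\<^sup>2" using s by (simp_all add: \<sigma>_def)
  \<comment> \<open>Lengths are measured in units of \<open>sqrt s\<close>, which removes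
    \<open>s\<close> from the exponents; the hypothesis on \<open>h\<close> becomes
    \<open>H \<le> 1\<close>.\<close>
  define X H where "X = norm x / \<sigma>" and "H = norm h / \<sigma>"
  have X: "0 \<le> X" and H: "0 \<le> H" "H \<le> 1"
    using \<sigma> h by (simp_all add: X_def H_def \<sigma>_def)
  define a b where "a = (norm (x + h))\<^sup>2 / (4 * s)" and "b = (norm x)\<^sup>2 / (4 * s)"
  have b: "b = X\<^sup>2 / 4" by (simp add: b_def X_def s_eq power_divide)
  define Y where "Y = norm (x + h) / \<sigma>"
  have a: "a = Y\<^sup>2 / 4" by (simp add: a_def Y_def s_eq power_divide)
  have "\<bar>norm (x + h) - norm x\<bar> \<le> norm h"
    using norm_triangle_ineq3[of "x + h" x] by simp
  then have "\<bar>Y - X\<bar> \<le> H"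
    using \<sigma> by (simp add: Y_def X_def H_def diff_divide_distrib[symmetric] divide_right_mono)
  then have YX: "\<bar>Y - X\<bar> \<le> H" "Y \<le> X + H" "X \<le> Y + H" by auto
  have Y: "0 \<le> Y" using \<sigma> by (simp add: Y_def)
  have "\<bar>a - b\<bar> = \<bar>Y - X\<bar> * (Y + X) / 4"
  proof -
    have "a - b = (Y - X) * (Y + X) / 4"
      by (simp add: a b power2_eq_square algebra_simps)
    then show ?thesis using X Y by (simp only: abs_mult abs_divide)
  qed
  also have "\<dots> \<le> H * (2 * X + 1) / 4"
    using YX X Y H by (intro divide_right_mono mult_mono) auto
  finally have ab: "\<bar>a - b\<bar> \<le> H * (2 * X + 1) / 4" .
  have "X\<^sup>2 \<le> 2 * Y\<^sup>2 + 2"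
  proof -
    have "X\<^sup>2 \<le> (Y + 1)\<^sup>2" using YX X H by (intro power_mono) auto
    also have "\<dots> \<le> 2 * Y\<^sup>2 + 2"
      using zero_le_power2[of "Y - 1"] by (simp add: power2_eq_square algebra_simps)
    finally show ?thesis .
  qed
  \<comment> \<open>Half of the Gaussian exponent \<open>X\<^sup>2 / 4\<close> survives at both
    points, up to the constant \<open>1 / 4\<close>, which is the source of the factor
    \<open>exp (1 / 4)\<close>.\<close>
  then have ca: "X\<^sup>2 / 8 - 1 / 4 \<le> a" and cb: "X\<^sup>2 / 8 - 1 / 4 \<le> b"
    using zero_le_power2[of X] unfolding a b by linarith+
  have "\<bar>exp (- a) - exp (- b)\<bar> \<le> \<bar>a - b\<bar> * exp (- (X\<^sup>2 / 8 - 1 / 4))"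
    by (rule abs_exp_minus_diff_le[OF ca cb])
  also have "\<dots> \<le> (H * (5 / 4 * exp (X\<^sup>2 / 16))) * exp (- (X\<^sup>2 / 8 - 1 / 4))"
  proof (rule mult_right_mono)
    \<comment> \<open>The factor linear in \<open>X\<close> is absorbed by half of the remaining
      decay. What is left, \<open>exp (- X\<^sup>2 / 16)\<close>, is the Gaussian of time
      \<open>4 * s\<close>. The constant \<open>5 / 4\<close> is \<open>1 + 1 / 4\<close>, from
      \<open>X / 2 + 1 / 4\<close>.\<close>
    have "X / 2 \<le> 1 + X\<^sup>2 / 16"
      using zero_le_power2[of "X - 4"] by (simp add: power2_eq_square algebra_simps)
    also have "\<dots> \<le> exp (X\<^sup>2 / 16)" by (rule exp_ge_add_one_self)
    finally have "X / 2 \<le> exp (X\<^sup>2 / 16)" .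
    moreover have "1 \<le> exp (X\<^sup>2 / 16)" by simp
    ultimately have "(2 * X + 1) / 4 \<le> 5 / 4 * exp (X\<^sup>2 / 16)"
      by argo
    then have "H * ((2 * X + 1) / 4) \<le> H * (5 / 4 * exp (X\<^sup>2 / 16))"
      using H by (intro mult_left_mono) auto
    with ab show "\<bar>a - b\<bar> \<le> H * (5 / 4 * exp (X\<^sup>2 / 16))" by simp
  qed simp
  also have "\<dots> = 5 / 4 * exp (1 / 4) * H * exp (- X\<^sup>2 / 16)"
  proof -
    have "exp (X\<^sup>2 / 16) * exp (- (X\<^sup>2 / 8 - 1 / 4)) = exp (1 / 4) * exp (- X\<^sup>2 / 16)"
      by (simp add: exp_add[symmetric])
    then show ?thesis by simp
  qed
  finally have E: "\<bar>exp (- a) - exp (- b)\<bar> \<le> 5 / 4 * exp (1 / 4) * H * exp (- X\<^sup>2 / 16)" .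
  define q where "q = (4 * pi * s) powr (- (real CARD('m) / 2))"
  have q0: "0 \<le> q" by (simp add: q_def)
  \<comment> \<open>Passing from time \<open>s\<close> to \<open>4 * s\<close> changes the
    normalisation by \<open>4\<close> to the power half the dimension, which is the factor
    \<open>2 ^ CARD('m)\<close>.\<close>
  have q: "q = 2 ^ CARD('m) * (4 * pi * (4 * s)) powr (- (real CARD('m) / 2))"
  proof -
    have "4 * pi * (4 * s) = 2 powr 2 * (4 * pi * s)" by simp
    then have "(4 * pi * (4 * s)) powr (- (real CARD('m) / 2)) = (2 powr 2) powr (- (real CARD('m) / 2)) * q"
      by (simp only: powr_mult q_def)
    also have "\<dots> = 2 powr (- real CARD('m)) * q"
      by (simp only: powr_powr) simp
    finally show ?thesis by (simp add: powr_minus powr_realpow)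
  qed
  have "\<bar>heat_kernel s (x + h) - heat_kernel s x\<bar> = q * \<bar>exp (- a) - exp (- b)\<bar>"
    using q0 by (simp add: heat_kernel_def q_def[symmetric] a_def b_def right_diff_distrib[symmetric] abs_mult)
  also have "\<dots> \<le> q * (5 / 4 * exp (1 / 4) * H * exp (- X\<^sup>2 / 16))"
    using E q0 by (intro mult_left_mono) auto
  also have "\<dots> = 5 / 4 * exp (1 / 4) * 2 ^ CARD('m) * H * heat_kernel (4 * s) x"
    by (simp add: q heat_kernel_def X_def s_eq power_divide)
  finally show ?thesis by (simp add: H_def \<sigma>_def)
qed

text \<open>The first bound is the triangle inequality with mass one for each kernel; the second
  integrates the pointwise comparison, where the kernel at time \<open>4 * s\<close> again has mass
  one.\<close>

lemma nn_integral_heat_kernel_translation: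
  fixes h :: "real ^ 'm"
  assumes s: "0 < s"
  shows "(\<integral>\<^sup>+x. \<bar>heat_kernel s (x + h) - heat_kernel s x\<bar> \<partial>lborel) \<le> 2"
    and "norm h \<le> sqrt s \<Longrightarrow> (\<integral>\<^sup>+x. \<bar>heat_kernel s (x + h) - heat_kernel s x\<bar> \<partial>lborel)
      \<le> ennreal (5 / 4 * exp (1 / 4) * 2 ^ CARD('m) * (norm h / sqrt s))"
proof -
  have "(\<integral>\<^sup>+x. \<bar>heat_kernel s (x + h) - heat_kernel s x\<bar> \<partial>lborel)
      \<le> (\<integral>\<^sup>+x. ennreal (heat_kernel s (x + h)) + ennreal (heat_kernel s x) \<partial>lborel)"
  proof (rule nn_integral_mono)
    fix x
    have "\<bar>heat_kernel s (x + h) - heat_kernel s x\<bar> \<le> heat_kernel s (x + h) + heat_kernel s x"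
      using heat_kernel_nonneg[of s x] heat_kernel_nonneg[of s "x + h"] by linarith
    from ennreal_leI[OF this]
    show "ennreal \<bar>heat_kernel s (x + h) - heat_kernel s x\<bar>
        \<le> ennreal (heat_kernel s (x + h)) + ennreal (heat_kernel s x)"
      by (simp add: heat_kernel_nonneg)
  qed
  also have "\<dots> = 1 + 1"
    using nn_integral_lborel_translation[of "\<lambda>x. ennreal (heat_kernel s x)" h]
    by (subst nn_integral_add) (simp_all add: nn_integral_heat_kernel[OF s])
  finally show "(\<integral>\<^sup>+x. \<bar>heat_kernel s (x + h) - heat_kernel s x\<bar> \<partial>lborel) \<le> 2" by simp
next
  assume h: "norm h \<le> sqrt s"
  let ?c = "5 / 4 * exp (1 / 4) * 2 ^ CARD('m) * (norm h / sqrt s)"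
  have c: "0 \<le> ?c" using s by simp
  have "(\<integral>\<^sup>+x. \<bar>heat_kernel s (x + h) - heat_kernel s x\<bar> \<partial>lborel)
      \<le> (\<integral>\<^sup>+x. ennreal ?c * ennreal (heat_kernel (4 * s) (x :: real ^ 'm)) \<partial>lborel)"
    unfolding ennreal_mult'[OF c, symmetric]
    by (intro nn_integral_mono ennreal_leI heat_kernel_translation_le s h)
  also have "\<dots> = ennreal ?c"
    using s by (subst nn_integral_cmult) (simp_all add: nn_integral_heat_kernel)
  finally show "(\<integral>\<^sup>+x. \<bar>heat_kernel s (x + h) - heat_kernel s x\<bar> \<partial>lborel) \<le> ennreal ?c" .
qed

section \<open>The Bessel kernel as a superposition of heat kernels\<close>

text \<open>The integrand of \<open>Gamma (r / 2)\<close>, extended by zero to the whole line so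
  that Tonelli can be used on \<open>lborel\<close>.\<close>

definition bessel_weight :: "real \<Rightarrow> real \<Rightarrow> real" where
  "bessel_weight r s = indicator {0<..} s * (s powr (r / 2 - 1) * exp (- s))"

lemma bessel_weight_measurable [measurable]: "bessel_weight r \<in> borel_measurable borel"
  unfolding bessel_weight_def by measurable

lemma bessel_weight_nonneg: "0 \<le> bessel_weight r s"
  by (simp add: bessel_weight_def)

lemma nn_integral_bessel_weight:
  assumes "0 < r"
  shows "(\<integral>\<^sup>+s. bessel_weight r s \<partial>lborel) = ennreal (Gamma (r / 2))"
proof -
  \<comment> \<open>The two indicators differ at \<open>t = 0\<close>, where both sides vanish
    because \<open>0 powr a = 0\<close>.\<close>
  have *: "indicator {0..} t * t powr (r / 2 - 1) / exp t = bessel_weight r t" for t :: real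
    by (cases "t = 0") (auto simp: bessel_weight_def exp_minus indicator_def divide_simps)
  have "ennreal (Gamma (r / 2))
      = (\<integral>\<^sup>+t. ennreal (indicator {0..} t * t powr (r / 2 - 1) / exp t) \<partial>lborel)"
    using assms by (intro Gamma_conv_nn_integral_real) auto
  also have "\<dots> = (\<integral>\<^sup>+s. bessel_weight r s \<partial>lborel)"
    by (simp only: *)
  finally show ?thesis by simp
qed

lemma bessel_kernel_eq:
  "bessel_kernel r x = (LINT s|lborel. bessel_weight r s * heat_kernel s x) / Gamma (r / 2)"
proof -
  have "(LINT s:{0<..}|lebesgue. s powr (r / 2 - 1) * exp (- s) * heat_kernel s x)
      = (LINT s|lebesgue. bessel_weight r s * heat_kernel s x)"
    by (simp add: set_lebesgue_integral_def bessel_weight_def mult.assoc)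
  also have "\<dots> = (LINT s|lborel. bessel_weight r s * heat_kernel s x)"
    by (rule integral_completion) measurable
  finally show ?thesis by (simp add: bessel_kernel_def)
qed

lemma ennreal_abs_divide_Gamma:
  assumes "0 < r"
  shows "ennreal \<bar>a / Gamma (r / 2)\<bar> = ennreal \<bar>a\<bar> * ennreal (inverse (Gamma (r / 2)))"
proof -
  have "0 < Gamma (r / 2)" using assms by (intro Gamma_real_pos) auto
  then have "\<bar>a / Gamma (r / 2)\<bar> = \<bar>a\<bar> * inverse (Gamma (r / 2))"
    by (simp only: divide_inverse abs_mult abs_inverse abs_of_pos)
  then show ?thesis by (simp only: ennreal_mult' abs_ge_zero)
qed

lemma bessel_kernel_measurable [measurable]:
  "(bessel_kernel r :: real ^ 'm \<Rightarrow> real) \<in> borel_measurable borel"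
  unfolding bessel_kernel_eq[abs_def] by measurable

lemma nn_integral_bessel_weight_heat_kernel:
  assumes "0 < r"
  shows "(\<integral>\<^sup>+x. \<integral>\<^sup>+s. bessel_weight r s * heat_kernel s (x :: real ^ 'm) \<partial>lborel \<partial>lborel)
    = ennreal (Gamma (r / 2))"
proof -
  have "(\<integral>\<^sup>+x. \<integral>\<^sup>+s. bessel_weight r s * heat_kernel s (x :: real ^ 'm) \<partial>lborel \<partial>lborel)
      = (\<integral>\<^sup>+s. \<integral>\<^sup>+x. bessel_weight r s * heat_kernel s (x :: real ^ 'm) \<partial>lborel \<partial>lborel)"
    by (rule lborel_pair.Fubini') measurable
  also have "\<dots> = (\<integral>\<^sup>+s. bessel_weight r s \<partial>lborel)"
  proof (rule nn_integral_cong)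
    fix s :: real
    show "(\<integral>\<^sup>+x. bessel_weight r s * heat_kernel s (x :: real ^ 'm) \<partial>lborel) = bessel_weight r s"
    proof (cases "0 < s")
      case True
      then show ?thesis
        by (simp add: ennreal_mult' bessel_weight_nonneg nn_integral_cmult nn_integral_heat_kernel)
    qed (simp add: bessel_weight_def)
  qed
  finally show ?thesis using assms by (simp add: nn_integral_bessel_weight)
qed

text \<open>The kernel is a Bochner integral, with the value \<open>0\<close> where it diverges, as
  at the origin when \<open>r\<close> is below the dimension. Finite total mass confines this to a
  null set.\<close>

lemma AE_integrable_bessel_kernel:
  assumes "0 < r"
  shows "AE x :: real ^ 'm in lborel. integrable lborel (\<lambda>s. bessel_weight r s * heat_kernel s x)"
proof -
  have "AE x :: real ^ 'm in lborel. (\<integral>\<^sup>+s. bessel_weight r s * heat_kernel s x \<partial>lborel) \<noteq> \<infinity>"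
    by (rule nn_integral_PInf_AE) (auto simp: nn_integral_bessel_weight_heat_kernel[OF assms])
  then show ?thesis
    by eventually_elim
      (auto intro!: integrableI_bounded simp: bessel_weight_nonneg heat_kernel_nonneg less_top)
qed

lemma nn_integral_bessel_kernel_finite:
  assumes r: "0 < r"
  shows "(\<integral>\<^sup>+x. norm (bessel_kernel r (x :: real ^ 'm)) \<partial>lborel) < \<infinity>"
proof -
  have "(\<integral>\<^sup>+x. norm (bessel_kernel r (x :: real ^ 'm)) \<partial>lborel)
      \<le> (\<integral>\<^sup>+x. (\<integral>\<^sup>+s. bessel_weight r s * heat_kernel s (x :: real ^ 'm) \<partial>lborel)
          * ennreal (inverse (Gamma (r / 2))) \<partial>lborel)"
    using AE_integrable_bessel_kernel[OF r, where 'm = 'm]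
  proof (intro nn_integral_mono_AE, eventually_elim)
    case (elim x)
    have "ennreal (norm (LINT s|lborel. bessel_weight r s * heat_kernel s x))
        \<le> (\<integral>\<^sup>+s. norm (bessel_weight r s * heat_kernel s x) \<partial>lborel)"
      using elim by (intro integral_norm_bound_ennreal) auto
    also have "\<dots> = (\<integral>\<^sup>+s. bessel_weight r s * heat_kernel s x \<partial>lborel)"
      by (simp add: bessel_weight_nonneg heat_kernel_nonneg)
    finally show ?case
      unfolding bessel_kernel_eq real_norm_def ennreal_abs_divide_Gamma[OF r]
      by (rule mult_right_mono) simp
  qed
  also have "\<dots> < \<infinity>"
    by (subst nn_integral_multc)
       (auto simp: nn_integral_bessel_weight_heat_kernel[OF r, where 'm = 'm] ennreal_mult_less_top)
  finally show ?thesis .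
qed

text \<open>Tonelli reduces the claim to an integral over \<open>s\<close>, split at the square of
  \<open>norm h\<close>, which is positive as \<open>h \<noteq> 0\<close>. Both pieces scale like
  \<open>norm h powr r\<close>.\<close>

lemma nn_integral_bessel_weight_heat_kernel_translation:
  fixes h :: "real ^ 'm"
  assumes r: "0 < r" "r < 1" and h: "h \<noteq> 0"
  shows "(\<integral>\<^sup>+x. \<integral>\<^sup>+s. bessel_weight r s * \<bar>heat_kernel s (x + h) - heat_kernel s x\<bar> \<partial>lborel \<partial>lborel)
    \<le> ennreal ((4 / r + 5 / 2 * exp (1 / 4) * 2 ^ CARD('m) / (1 - r)) * norm h powr r)"
proof -
  define C :: real where "C = 5 / 4 * exp (1 / 4) * 2 ^ CARD('m)"
  define d where "d = norm h"
  have C: "0 \<le> C" by (simp add: C_def)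
  have d: "0 < d" using h by (simp add: d_def)
  \<comment> \<open>With \<open>exp (- s) \<le> 1\<close>, \<open>?f\<close> is the weight for small
    \<open>s\<close>, where the bound \<open>2\<close> is used, and \<open>?g\<close> is the weight
    divided by \<open>sqrt s\<close> for large \<open>s\<close>. The first is integrable at
    \<open>0\<close> because \<open>r > 0\<close>, the second at infinity because
    \<open>r < 1\<close>.\<close>
  let ?f = "\<lambda>s. s powr (r / 2 - 1) * indicator {0..d\<^sup>2} s"
  let ?g = "\<lambda>s. s powr (r / 2 - 3 / 2) * indicator {d\<^sup>2..} s"
  have f: "(\<integral>\<^sup>+s. ?f s \<partial>lborel) = ennreal (2 / r * d powr r)"
  proof -
    have "((\<lambda>s. s powr (r / 2 - 1)) has_integral ((d\<^sup>2) powr (r / 2 - 1 + 1) / (r / 2 - 1 + 1))) {0..d\<^sup>2}"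
      using r by (intro has_integral_powr_from_0) auto
    from nn_integral_has_integral_lebesgue[OF _ this] show ?thesis
      using d r by (simp add: mult.commute powr_powr flip: powr_numeral)
  qed
  have g: "(\<integral>\<^sup>+s. ?g s \<partial>lborel) = ennreal (2 / (1 - r) * d powr (r - 1))"
  proof -
    have "((\<lambda>s. s powr (r / 2 - 3 / 2)) has_integral
        - ((d\<^sup>2) powr (r / 2 - 3 / 2 + 1) / (r / 2 - 3 / 2 + 1))) {d\<^sup>2..}"
      using r d has_integral_powr_to_inf[of "r / 2 - 3 / 2" "d\<^sup>2"] by simp
    from nn_integral_has_integral_lebesgue[OF _ this]
    have "(\<integral>\<^sup>+s. ?g s \<partial>lborel) = ennreal (- ((d\<^sup>2) powr (r / 2 - 3 / 2 + 1) / (r / 2 - 3 / 2 + 1)))"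
      by (simp add: mult.commute)
    also have "(d\<^sup>2) powr (r / 2 - 3 / 2 + 1) = d powr (2 * (r / 2 - 3 / 2 + 1))"
      using d by (simp add: powr_powr flip: powr_numeral)
    also have "2 * (r / 2 - 3 / 2 + 1) = r - 1"
      by simp
    also have "- (d powr (r - 1) / (r / 2 - 3 / 2 + 1)) = 2 / (1 - r) * d powr (r - 1)"
      using r by (simp add: field_simps)
    finally show ?thesis .
  qed
  have "(\<integral>\<^sup>+x. \<integral>\<^sup>+s. bessel_weight r s * \<bar>heat_kernel s (x + h) - heat_kernel s x\<bar> \<partial>lborel \<partial>lborel)
      = (\<integral>\<^sup>+s. \<integral>\<^sup>+x. bessel_weight r s * \<bar>heat_kernel s (x + h) - heat_kernel s x\<bar> \<partial>lborel \<partial>lborel)"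
    by (rule lborel_pair.Fubini') measurable
  also have "\<dots> \<le> (\<integral>\<^sup>+s. 2 * ennreal (?f s) + ennreal (C * d) * ennreal (?g s) \<partial>lborel)"
  proof (rule nn_integral_mono)
    fix s :: real
    have *: "(\<integral>\<^sup>+x. bessel_weight r s * \<bar>heat_kernel s (x + h) - heat_kernel s x\<bar> \<partial>lborel)
        = ennreal (bessel_weight r s) * (\<integral>\<^sup>+x. \<bar>heat_kernel s (x + h) - heat_kernel s x\<bar> \<partial>lborel)"
      by (simp add: ennreal_mult' bessel_weight_nonneg nn_integral_cmult)
    consider "s \<le> 0" | "0 < s" "s \<le> d\<^sup>2" | "0 < s" "d\<^sup>2 \<le> s" by linarith
    then show "(\<integral>\<^sup>+x. bessel_weight r s * \<bar>heat_kernel s (x + h) - heat_kernel s x\<bar> \<partial>lborel)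
        \<le> 2 * ennreal (?f s) + ennreal (C * d) * ennreal (?g s)"
    proof cases
      case 1
      then show ?thesis by (simp add: bessel_weight_def)
    next
      case 2
      have "bessel_weight r s \<le> ?f s"
        using 2 by (simp add: bessel_weight_def mult_left_le)
      then have "ennreal (bessel_weight r s) * (\<integral>\<^sup>+x. \<bar>heat_kernel s (x + h) - heat_kernel s x\<bar> \<partial>lborel)
          \<le> ennreal (?f s) * 2"
        by (intro mult_mono ennreal_leI nn_integral_heat_kernel_translation 2) auto
      then show ?thesis
        unfolding * by (simp add: mult.commute add_increasing2)
    next
      case 3
      have le: "norm h \<le> sqrt s"
        using 3 d real_le_rsqrt[of d s] by (simp add: d_def)
      have "bessel_weight r s \<le> s powr (r / 2 - 1)"
        using 3 by (simp add: bessel_weight_def mult_left_le)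
      then have "ennreal (bessel_weight r s) * (\<integral>\<^sup>+x. \<bar>heat_kernel s (x + h) - heat_kernel s x\<bar> \<partial>lborel)
          \<le> ennreal (s powr (r / 2 - 1)) * ennreal (C * (d / sqrt s))"
        unfolding C_def d_def
        by (intro mult_mono ennreal_leI nn_integral_heat_kernel_translation(2) 3 le) auto
      also have "\<dots> = ennreal (C * d) * ennreal (?g s)"
      proof -
        have "s powr (r / 2 - 1) / sqrt s = s powr (r / 2 - 3 / 2)"
          using 3 by (simp add: powr_half_sqrt[symmetric] powr_diff[symmetric])
        then have "s powr (r / 2 - 1) * (C * (d / sqrt s)) = C * d * ?g s"
          using 3 by (simp add: field_simps)
        then show ?thesis
          using C d by (simp add: ennreal_mult'[symmetric])
      qed
      finally show ?thesis
        unfolding * by (simp add: add_increasing)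
    qed
  qed
  also have "\<dots> = 2 * ennreal (2 / r * d powr r) + ennreal (C * d) * ennreal (2 / (1 - r) * d powr (r - 1))"
    by (subst nn_integral_add) (simp_all add: nn_integral_cmult f g)
  also have "\<dots> = ennreal (2 * (2 / r * d powr r) + C * d * (2 / (1 - r) * d powr (r - 1)))"
  proof -
    have "2 * ennreal a + ennreal b * ennreal c = ennreal (2 * a + b * c)"
      if "0 \<le> a" "0 \<le> b" "0 \<le> c" for a b c
      using that by (simp add: ennreal_mult)
    then show ?thesis using r C d by simp
  qed
  also have "2 * (2 / r * d powr r) + C * d * (2 / (1 - r) * d powr (r - 1))
      = (4 / r + 5 / 2 * exp (1 / 4) * 2 ^ CARD('m) / (1 - r)) * norm h powr r"
    using r d by (simp add: d_def[symmetric] C_def powr_diff field_simps)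
  finally show ?thesis .
qed

lemma nn_integral_bessel_kernel_translation:
  assumes r: "0 < r" "r < 1"
  obtains c where "0 < c"
    "\<And>h :: real ^ 'm. h \<noteq> 0 \<Longrightarrow>
      (\<integral>\<^sup>+x. norm (bessel_kernel r (x + h) - bessel_kernel r x) \<partial>lborel) \<le> ennreal (c * norm h powr r)"
proof
  define D where "D = 4 / r + 5 / 2 * exp (1 / 4) * 2 ^ CARD('m) / (1 - r)"
  have G: "0 < Gamma (r / 2)" using r by (intro Gamma_real_pos) auto
  have D: "0 < D" using r unfolding D_def by (intro add_pos_nonneg) auto
  show "0 < D / Gamma (r / 2)" using D G by simp
  fix h :: "real ^ 'm" assume h: "h \<noteq> 0"
  have "(\<integral>\<^sup>+x. norm (bessel_kernel r (x + h) - bessel_kernel r x) \<partial>lborel)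
      \<le> (\<integral>\<^sup>+x. (\<integral>\<^sup>+s. bessel_weight r s * \<bar>heat_kernel s (x + h) - heat_kernel s x\<bar> \<partial>lborel)
          * ennreal (inverse (Gamma (r / 2))) \<partial>lborel)"
    using AE_integrable_bessel_kernel[OF r(1), where 'm = 'm]
      AE_lborel_translation[OF AE_integrable_bessel_kernel[OF r(1)], of h]
  proof (intro nn_integral_mono_AE, eventually_elim)
    case (elim x)
    let ?d = "\<lambda>s. bessel_weight r s * heat_kernel s (x + h) - bessel_weight r s * heat_kernel s x"
    have "ennreal (norm (LINT s|lborel. ?d s)) \<le> (\<integral>\<^sup>+s. norm (?d s) \<partial>lborel)"
      using elim by (intro integral_norm_bound_ennreal) auto
    also have "\<dots> = (\<integral>\<^sup>+s. bessel_weight r s * \<bar>heat_kernel s (x + h) - heat_kernel s x\<bar> \<partial>lborel)"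
      by (simp only: right_diff_distrib[symmetric] real_norm_def abs_mult abs_of_nonneg[OF bessel_weight_nonneg])
    finally have "ennreal (norm (LINT s|lborel. ?d s)) * ennreal (inverse (Gamma (r / 2)))
        \<le> (\<integral>\<^sup>+s. bessel_weight r s * \<bar>heat_kernel s (x + h) - heat_kernel s x\<bar> \<partial>lborel)
          * ennreal (inverse (Gamma (r / 2)))"
      by (rule mult_right_mono) simp
    moreover have "bessel_kernel r (x + h) - bessel_kernel r x = (LINT s|lborel. ?d s) / Gamma (r / 2)"
      using elim
      by (subst Bochner_Integration.integral_diff) (auto simp: bessel_kernel_eq diff_divide_distrib)
    ultimately show ?case
      by (simp only: real_norm_def ennreal_abs_divide_Gamma[OF r(1)])
  qed
  also have "\<dots> \<le> ennreal (D * norm h powr r) * ennreal (inverse (Gamma (r / 2)))"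
    using nn_integral_bessel_weight_heat_kernel_translation[OF r h]
    by (subst nn_integral_multc) (auto intro!: mult_right_mono simp: D_def)
  also have "\<dots> = ennreal (D * norm h powr r * inverse (Gamma (r / 2)))"
    using G by (intro ennreal_mult''[symmetric]) simp
  also have "D * norm h powr r * inverse (Gamma (r / 2)) = D / Gamma (r / 2) * norm h powr r"
    using G by (simp add: field_simps)
  finally show "(\<integral>\<^sup>+x. norm (bessel_kernel r (x + h) - bessel_kernel r x) \<partial>lborel)
      \<le> ennreal (D / Gamma (r / 2) * norm h powr r)" .
qed

section \<open>Borel representatives and extended L^p norms\<close>

text \<open>The convolution results concern Borel functions, whereas densities are only Lebesgue
  measurable. The real-valued case is applied to each coordinate, and the finitely many null sets
  are joined.\<close>

lemma lebesgue_measurable_borel_representative: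
  fixes g :: "'a::euclidean_space \<Rightarrow> 'b::euclidean_space"
  assumes [measurable]: "g \<in> borel_measurable lebesgue"
  obtains g' where "g' \<in> borel_measurable borel" "AE x in lborel. g x = g' x"
proof -
  have "\<exists>c. c \<in> borel_measurable borel \<and> (AE x in lborel. g x \<bullet> b = c x)" for b
    using completion_ex_borel_measurable_real[of "\<lambda>x. g x \<bullet> b" lborel] by auto
  then have "\<exists>c. \<forall>b. c b \<in> borel_measurable borel \<and> (AE x in lborel. g x \<bullet> b = c b x)"
    by (intro choice) blast
  then obtain c where c: "\<And>b. c b \<in> borel_measurable borel"
    "\<And>b. AE x in lborel. g x \<bullet> b = c b x"
    by blast
  show thesis
  proof
    show "(\<lambda>x. \<Sum>b\<in>Basis. c b x *\<^sub>R b) \<in> borel_measurable borel"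
      using c by measurable
    have "AE x in lborel. \<forall>b\<in>Basis. g x \<bullet> b = c b x"
      using c by (intro AE_finite_allI) auto
    then show "AE x in lborel. g x = (\<Sum>b\<in>Basis. c b x *\<^sub>R b)"
      by eventually_elim (metis (no_types, lifting) euclidean_representation sum.cong)
  qed
qed

text \<open>Takes \<open>p\<close>-th roots and settles the infinite case once: as
  \<open>A > 0\<close>, the right side is infinite unless \<open>g\<close> has finite norm.
  Measurability of \<open>f\<close> is part of the premise because \<open>lp_norm\<close> is
  infinite without it.\<close>

lemma lp_norm_le_cmult:
  assumes p: "1 \<le> p" and A: "0 < A"
    and *: "lp_norm p g < \<infinity> \<Longrightarrow> f \<in> borel_measurable lebesgue \<and>
      (\<integral>\<^sup>+x. norm (f x) powr p \<partial>lebesgue) \<le> ennreal (A powr p) * (\<integral>\<^sup>+x. norm (g x) powr p \<partial>lebesgue)"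
  shows "lp_norm p f \<le> ennreal A * lp_norm p g"
proof (cases "lp_norm p g < \<infinity>")
  case False
  then show ?thesis using A by (simp add: ennreal_mult_top less_top[symmetric])
next
  case True
  define I where "I = (\<integral>\<^sup>+x. norm (f x) powr p \<partial>lebesgue)"
  define J where "J = (\<integral>\<^sup>+x. norm (g x) powr p \<partial>lebesgue)"
  have J: "J < \<infinity>" and g: "lp_norm p g = ennreal (enn2real J powr (1 / p))"
    using True unfolding lp_norm_def J_def[symmetric] by (auto simp: Let_def split: if_splits)
  have f: "f \<in> borel_measurable lebesgue" and IJ: "I \<le> ennreal (A powr p) * J"
    using *[OF True] by (simp_all add: I_def J_def)
  have fin: "ennreal (A powr p) * J < \<infinity>"
    using J by (simp add: ennreal_mult_less_top)
  with IJ have I: "I < \<infinity>" by (rule le_less_trans)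
  have "enn2real I \<le> A powr p * enn2real J"
    using enn2real_mono[OF IJ] fin by (simp add: enn2real_mult)
  then have "enn2real I powr (1 / p) \<le> (A powr p * enn2real J) powr (1 / p)"
    using p by (intro powr_mono2) auto
  also have "\<dots> = A * enn2real J powr (1 / p)"
    using A p by (simp add: powr_mult powr_powr)
  finally have "ennreal (enn2real I powr (1 / p)) \<le> ennreal A * ennreal (enn2real J powr (1 / p))"
    using A by (simp add: ennreal_mult'[symmetric] ennreal_leI)
  then show ?thesis
    using f I g by (simp add: lp_norm_def I_def[symmetric] Let_def)
qed

lemma bessel_potential_cong_AE:
  assumes r: "0 < r" and [measurable]: "g \<in> borel_measurable lebesgue" "g' \<in> borel_measurable borel"
    and g: "AE x in lborel. g x = g' x"
  shows "bessel_potential r g x = (LINT y|lborel. bessel_kernel r (x - y) *\<^sub>R g' y)"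
proof -
  have [measurable]: "(\<lambda>y. bessel_kernel r (x - y)) \<in> borel_measurable lebesgue"
    "g' \<in> borel_measurable lebesgue"
    by (auto intro!: measurable_completion)
  have "bessel_potential r g x = (LINT y|lebesgue. bessel_kernel r (x - y) *\<^sub>R g' y)"
    using r AE_completion[OF g] unfolding bessel_potential_def
    by (auto intro!: integral_cong_AE)
  also have "\<dots> = (LINT y|lborel. bessel_kernel r (x - y) *\<^sub>R g' y)"
    by (rule integral_completion) measurable
  finally show ?thesis .
qed

text \<open>Lebesgue measure is complete, so agreeing almost everywhere with a Borel function
  suffices.\<close>

lemma lebesgue_measurable_translation_diff:
  fixes f b :: "'a::euclidean_space \<Rightarrow> 'b::euclidean_space"
  assumes [measurable]: "b \<in> borel_measurable borel" and f: "AE x in lborel. f x = b x"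
  shows "(\<lambda>x. f (x + h) - f x) \<in> borel_measurable lebesgue"
proof -
  have "AE x in lborel. b (x + h) - b x = f (x + h) - f x"
    using f AE_lborel_translation[OF f, of h] by eventually_elim simp
  then have "AE x in lebesgue. b (x + h) - b x = f (x + h) - f x"
    by (rule AE_completion)
  then show ?thesis
    by (rule borel_measurable_AE[rotated]) (auto intro!: measurable_completion)
qed

section \<open>Translation estimates in Bessel potential spaces\<close>

text \<open>The constant is the one in the L^1 estimate for the kernel. Young's inequality passes it
  on unchanged for every exponent, which is why \<open>c\<close> precedes \<open>p\<close>.\<close>

lemma lp_norm_translation_diff_bessel_potential:
  assumes r: "0 < r" "r < 1"
  shows "\<exists>c>0. \<forall>p (f :: real ^ 'm \<Rightarrow> real ^ 'm) g h. 1 \<le> p \<longrightarrow> is_bessel_density p r f g \<longrightarrow> h \<noteq> 0 \<longrightarrow>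
    lp_norm p (\<lambda>x. f (x + h) - f x) \<le> ennreal (c * norm h powr r) * lp_norm p g"
proof -
  obtain c where c: "0 < c" "\<And>h :: real ^ 'm. h \<noteq> 0 \<Longrightarrow>
      (\<integral>\<^sup>+x. norm (bessel_kernel r (x + h) - bessel_kernel r x) \<partial>lborel) \<le> ennreal (c * norm h powr r)"
    using nn_integral_bessel_kernel_translation[OF r] by blast
  show ?thesis
  proof (intro exI[of _ c] conjI c(1) allI impI)
    fix p :: real and h :: "real ^ 'm" and f g :: "real ^ 'm \<Rightarrow> real ^ 'm"
    assume p: "1 \<le> p" and fg: "is_bessel_density p r f g" and h: "h \<noteq> 0"
    have A: "0 < c * norm h powr r" using c h by simp
    have f: "AE x in lborel. f x = bessel_potential r g x"
      using fg by (simp add: is_bessel_density_def AE_completion_iff)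
    have gm: "g \<in> borel_measurable lebesgue" and gI: "(\<integral>\<^sup>+x. norm (g x) powr p \<partial>lborel) < \<infinity>"
      using fg by (auto simp: is_bessel_density_def lp_norm_def Let_def nn_integral_completion split: if_splits)
    obtain g' where g'm [measurable]: "g' \<in> borel_measurable borel" and gg': "AE x in lborel. g x = g' x"
      using lebesgue_measurable_borel_representative[OF gm] by blast
    have gI': "(\<integral>\<^sup>+x. norm (g' x) powr p \<partial>lborel) = (\<integral>\<^sup>+x. norm (g x) powr p \<partial>lborel)"
      using gg' by (intro nn_integral_cong_AE) auto
    have f': "AE x in lborel. f x = (LINT y|lborel. bessel_kernel r (x - y) *\<^sub>R g' y)"
      using f bessel_potential_cong_AE[OF r(1) gm g'm gg'] by simp
    have "(\<lambda>x. f (x + h) - f x) \<in> borel_measurable lebesgue"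
      using f' by (rule lebesgue_measurable_translation_diff[rotated]) measurable
    moreover have "(\<integral>\<^sup>+x. norm (f (x + h) - f x) powr p \<partial>lborel)
        \<le> ennreal ((c * norm h powr r) powr p) * (\<integral>\<^sup>+y. norm (g' y) powr p \<partial>lborel)"
      using gI gI' r by (intro nn_integral_convolution_translation[where G = "bessel_kernel r"]
        bessel_kernel_measurable g'm nn_integral_bessel_kernel_finite p A c h f') auto
    ultimately show "lp_norm p (\<lambda>x. f (x + h) - f x) \<le> ennreal (c * norm h powr r) * lp_norm p g"
      by (intro lp_norm_le_cmult p A) (simp add: nn_integral_completion gI')
  qed
qed

text \<open>The case \<open>r = 0\<close>. Pointwise, the \<open>p\<close>-th power of a sum is at
  most \<open>2 powr p\<close> times the sum of the \<open>p\<close>-th powers; integration gives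
  another factor \<open>2\<close>, and \<open>2 * 2 powr p \<le> 4 powr p\<close> since
  \<open>p \<ge> 1\<close>. The constant \<open>4\<close> is not sharp but is uniform in
  \<open>p\<close>.\<close>

lemma lp_norm_translation_diff_le:
  fixes f g :: "real ^ 'm \<Rightarrow> real ^ 'm"
  assumes p: "1 \<le> p" and fg: "AE x in lebesgue. f x = g x"
  shows "lp_norm p (\<lambda>x. f (x + h) - f x) \<le> ennreal 4 * lp_norm p g"
proof (rule lp_norm_le_cmult[OF p])
  assume g: "lp_norm p g < \<infinity>"
  then have gm: "g \<in> borel_measurable lebesgue"
    by (auto simp: lp_norm_def Let_def split: if_splits)
  obtain g' where [measurable]: "g' \<in> borel_measurable borel" and gg': "AE x in lborel. g x = g' x"
    using lebesgue_measurable_borel_representative[OF gm] by blast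
  have f: "AE x in lborel. f x = g' x"
    using gg' fg[unfolded AE_completion_iff] by eventually_elim simp
  have "(\<lambda>x. f (x + h) - f x) \<in> borel_measurable lebesgue"
    using f by (rule lebesgue_measurable_translation_diff[rotated]) measurable
  moreover have "(\<integral>\<^sup>+x. norm (f (x + h) - f x) powr p \<partial>lborel)
      \<le> ennreal (4 powr p) * (\<integral>\<^sup>+x. norm (g x) powr p \<partial>lborel)"
  proof -
    have "(\<integral>\<^sup>+x. norm (f (x + h) - f x) powr p \<partial>lborel)
        \<le> (\<integral>\<^sup>+x. ennreal (2 powr p) * (ennreal (norm (g' (x + h)) powr p) + ennreal (norm (g' x) powr p)) \<partial>lborel)"
      using f AE_lborel_translation[OF f, of h]
    proof (intro nn_integral_mono_AE, eventually_elim)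
      case (elim x)
      define a b where "a = norm (g' (x + h))" and "b = norm (g' x)"
      have ab: "0 \<le> a" "0 \<le> b" by (simp_all add: a_def b_def)
      have "norm (f (x + h) - f x) \<le> a + b"
        using elim by (simp add: a_def b_def norm_triangle_ineq4)
      also have "\<dots> \<le> 2 * max a b" by simp
      finally have "norm (f (x + h) - f x) powr p \<le> (2 * max a b) powr p"
        using p by (intro powr_mono2) auto
      also have "\<dots> = 2 powr p * max a b powr p"
        using ab by (simp add: powr_mult)
      also have "\<dots> \<le> 2 powr p * (a powr p + b powr p)"
        by (intro mult_left_mono) (auto simp: max_def)
      finally have "ennreal (norm (f (x + h) - f x) powr p) \<le> ennreal (2 powr p * (a powr p + b powr p))"
        by (rule ennreal_leI)
      then show ?case
        by (simp add: a_def b_def ennreal_mult')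
    qed
    also have "\<dots> = ennreal (2 powr p) * (2 * (\<integral>\<^sup>+x. norm (g' x) powr p \<partial>lborel))"
      using nn_integral_lborel_translation[of "\<lambda>x. ennreal (norm (g' x) powr p)" h]
      by (simp add: nn_integral_cmult nn_integral_add mult_2)
    also have "\<dots> \<le> ennreal (4 powr p) * (\<integral>\<^sup>+x. norm (g' x) powr p \<partial>lborel)"
    proof -
      have "2 powr 1 \<le> (2 :: real) powr p"
        using p by (intro powr_mono) auto
      then have "2 powr p * 2 \<le> 2 powr p * (2 :: real) powr p"
        by (intro mult_left_mono) auto
      also have "\<dots> = (4 :: real) powr p"
        by (simp add: powr_mult[symmetric])
      finally have "ennreal (2 powr p) * ennreal 2 \<le> ennreal (4 powr p)"
        by (simp add: ennreal_mult'[symmetric] ennreal_leI del: ennreal_numeral)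
      then show ?thesis
        unfolding mult.assoc[symmetric] by (intro mult_right_mono) auto
    qed
    also have "(\<integral>\<^sup>+x. norm (g' x) powr p \<partial>lborel) = (\<integral>\<^sup>+x. norm (g x) powr p \<partial>lborel)"
      using gg' by (intro nn_integral_cong_AE) auto
    finally show ?thesis .
  qed
  ultimately show "(\<lambda>x. f (x + h) - f x) \<in> borel_measurable lebesgue \<and>
      (\<integral>\<^sup>+x. norm (f (x + h) - f x) powr p \<partial>lebesgue)
      \<le> ennreal (4 powr p) * (\<integral>\<^sup>+x. norm (g x) powr p \<partial>lebesgue)"
    by (simp add: nn_integral_completion)
qed simp

lemma lp_norm_translation_diff_bessel_norm:
  assumes r: "0 \<le> r" "r < 1"
  obtains c where "0 < c"
    "\<And>p (f :: real ^ 'm \<Rightarrow> real ^ 'm) h. 1 \<le> p \<Longrightarrow>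
      lp_norm p (\<lambda>x. f (x + h) - f x) \<le> ennreal (c * norm h powr r) * bessel_norm p r f"
proof -
  have "\<exists>c>0. \<forall>p (f :: real ^ 'm \<Rightarrow> real ^ 'm) g h. 1 \<le> p \<longrightarrow> is_bessel_density p r f g \<longrightarrow> h \<noteq> 0 \<longrightarrow>
      lp_norm p (\<lambda>x. f (x + h) - f x) \<le> ennreal (c * norm h powr r) * lp_norm p g"
  proof (cases "r = 0")
    case True
    have "lp_norm p (\<lambda>x. f (x + h) - f x) \<le> ennreal (4 * norm h powr r) * lp_norm p g"
      if "1 \<le> p" "is_bessel_density p r f g" "h \<noteq> 0" for p h and f g :: "real ^ 'm \<Rightarrow> real ^ 'm"
      using lp_norm_translation_diff_le[OF that(1), of f g h] that True
      by (simp add: is_bessel_density_def bessel_potential_def)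
    then show ?thesis by (intro exI[of _ 4]) auto
  next
    case False
    then have "0 < r" using r by simp
    then show ?thesis using r(2) by (rule lp_norm_translation_diff_bessel_potential)
  qed
  then obtain c where c: "0 < c" "\<And>p (f :: real ^ 'm \<Rightarrow> real ^ 'm) g h. 1 \<le> p \<Longrightarrow>
      is_bessel_density p r f g \<Longrightarrow> h \<noteq> 0 \<Longrightarrow>
      lp_norm p (\<lambda>x. f (x + h) - f x) \<le> ennreal (c * norm h powr r) * lp_norm p g"
    by blast
  show thesis
  proof (rule that[OF c(1)])
    fix p :: real and h :: "real ^ 'm" and f :: "real ^ 'm \<Rightarrow> real ^ 'm" assume p: "1 \<le> p"
    \<comment> \<open>For \<open>h = 0\<close> both sides vanish, also when \<open>r = 0\<close>,
      since \<open>0 powr 0 = 0\<close>. Outside the Bessel space the right side is infinite, its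
      factor \<open>c * norm h powr r\<close> being positive.\<close>
    consider "h = 0" | "h \<noteq> 0" "f \<in> bessel_space p r" | "h \<noteq> 0" "f \<notin> bessel_space p r" by blast
    then show "lp_norm p (\<lambda>x. f (x + h) - f x) \<le> ennreal (c * norm h powr r) * bessel_norm p r f"
    proof cases
      case 1
      then show ?thesis by (simp add: lp_norm_def)
    next
      case 2
      \<comment> \<open>The estimate holds for any density, in particular for the one selected in
        \<open>bessel_norm\<close>.\<close>
      then have "is_bessel_density p r f (SOME g. is_bessel_density p r f g)"
        unfolding bessel_space_def by (intro someI_ex[where P = "is_bessel_density p r f"]) simp
      from c(2)[OF p this] show ?thesis
        using 2 by (simp add: bessel_norm_def)
    next
      case 3
      then show ?thesis using c(1) by (simp add: bessel_norm_def ennreal_mult_top)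
    qed
  qed
qed

theorem proposition4p5:
  fixes r :: real
  assumes "CARD('m::finite) \<ge> 3" and "0 \<le> r" and "r < 1"
  shows "\<exists>c\<ge>0. \<forall>(u0 :: real ^ 'm \<Rightarrow> real ^ 'm) u.
    weak_solution u0 u \<and> weakly_continuous_version u0 u \<longrightarrow>
    (let v = (\<lambda>t x. u t x - heat_semigroup t u0 x) in
     \<forall>t\<ge>0. \<forall>p. 1 \<le> p \<and> p < real CARD('m) / (real CARD('m) - 1 + r) \<longrightarrow>
       (\<forall>h. norm h \<le> 1 \<longrightarrow>
          lp_norm p (\<lambda>x. v t (x + h) - v t x)
            \<le> ennreal (c * norm h powr r) * bessel_norm p r (v t)))"
proof -
  \<comment> \<open>This \<open>c\<close> is fixed by \<open>r\<close> and the dimension alone; the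
    bound is then used with \<open>v t\<close> in place of \<open>f\<close>.\<close>
  obtain c where c: "0 < c" "\<And>p (f :: real ^ 'm \<Rightarrow> real ^ 'm) h. 1 \<le> p \<Longrightarrow>
      lp_norm p (\<lambda>x. f (x + h) - f x) \<le> ennreal (c * norm h powr r) * bessel_norm p r f"
    using lp_norm_translation_diff_bessel_norm[OF assms(2,3)] by blast
  show ?thesis
    unfolding Let_def using c by (intro exI[of _ c]) auto
qed

end
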